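(* Let $p$ and $q$ be two distinct odd primes with $p\mid (q-1)$. Define the $pq^2$-periodic binary sequence $(\widehat{s}_t)_{t\ge 0}$ by $$\widehat{s}_t=\begin{cases}0, & \text{if } 0\le \dfrac{Q_{pq}(t)}{pq}<\dfrac12,\\[2mm] 1, & \text{if } \dfrac12\le \dfrac{Q_{pq}(t)}{pq}<1,\end{cases}$$ where $Q_{pq}$ is the Euler quotient function modulo $pq$. Then $$\sum_{t=0}^{pq^2-1}(-1)^{\widehat{s}_t+\widehat{s}_{t+pq}+\widehat{s}_{t+2pq}+\widehat{s}_{t+3pq}}=\frac13\,pq^2+\frac23\,q^2+O\left(p\,q^{\frac32}(\log pq)^4\right),$$ where the implied constant is absolute.
   Context: $\phi$ is Euler's totient function. For an odd integer $m\ge 2$ and an integer $n$ with $\gcd(n,m)=1$, the Euler quotient $Q_m(n)$ is the unique integer with $0\le Q_m(n)<m$ and $Q_m(n)\equiv \frac{n^{\phi(m)}-1}{m}\pmod m$; if $\gcd(n,m)>1$, then $Q_m(n)=0$. Here $m=pq$. The notation $\log pq$ means $\log(pq)$. *)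

theory Defs
  imports Complex_Main "HOL-Number_Theory.Number_Theory"
begin

definition euler_quotient :: "nat \<Rightarrow> int \<Rightarrow> int" where
  "euler_quotient m n =
     (if coprime n (int m) then ((n ^ totient m - 1) div int m) mod int m else 0)"

(* The division is exact and the representative lies in {0..<m}. *)
lemma euler_quotient_unique:
  assumes "m \<ge> 2" "coprime n (int m)"
  shows "int m dvd n ^ totient m - 1"
    and "x = euler_quotient m n \<longleftrightarrow>
           0 \<le> x \<and> x < int m \<and> [x = (n ^ totient m - 1) div int m] (mod int m)"
proof -
  have "[n ^ totient m = 1] (mod int m)"
  proof -
    have m: "int m > 0" using assms(1) by simp
    define k where "k = nat (n mod int m)"
    have k: "int k = n mod int m" using m by (simp add: k_def)
    have "coprime (int k) (int m)" using assms(2) m by (simp add: k)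
    then have "[k ^ totient m = 1] (mod m)" using euler_theorem by auto
    then have "[int k ^ totient m = 1] (mod int m)"
      by (metis cong_int_iff of_nat_1 of_nat_power)
    moreover have "[int k = n] (mod int m)" by (simp add: k cong_def)
    ultimately show ?thesis by (meson cong_pow cong_sym cong_trans)
  qed
  then show "int m dvd n ^ totient m - 1" by (simp add: cong_iff_dvd_diff)
  show "x = euler_quotient m n \<longleftrightarrow>
           0 \<le> x \<and> x < int m \<and> [x = (n ^ totient m - 1) div int m] (mod int m)"
    using assms by (auto simp: euler_quotient_def cong_def)
qed

definition s_hat :: "nat \<Rightarrow> nat \<Rightarrow> nat \<Rightarrow> nat" where
  "s_hat p q t =
     (let x = real_of_int (euler_quotient (p * q) (int t)) / real (p * q)
      in if 0 \<le> x \<and> x < 1 / 2 then 0 else 1)"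

lemma s_hat_periodic:
  assumes "prime p" "prime q" "p \<noteq> q" "p dvd q - 1"
  shows "s_hat p q (t + p * q ^ 2) = s_hat p q t"
proof -
  define m n where "m = p * q" and "n = totient (p * q)"
  define a b where "a = int (t + p * q ^ 2)" and "b = int t"
  have m0: "int m > 0" using assms by (simp add: m_def prime_gt_0_nat)
  have ab: "a - b = int m * int q" by (simp add: a_def b_def m_def power2_eq_square)
  then have a: "a = b + int m * int q" by simp
  have cop: "coprime a (int m) \<longleftrightarrow> coprime b (int m)"
    unfolding a by (metis coprime_iff_gcd_eq_1 gcd_add_mult gcd.commute mult.commute add.commute)
  have pn: "int p dvd int n"
  proof -
    have "coprime p q" using assms by (simp add: primes_coprime)
    then have "n = (p - 1) * (q - 1)"
      using assms by (simp add: n_def totient_mult_coprime totient_prime)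
    then show ?thesis using assms(4) by auto
  qed
  have "int p dvd (\<Sum>i<n. a ^ i * b ^ (n - Suc i))"
  proof -
    have c: "[a = b] (mod int p)" by (simp add: a m_def cong_iff_dvd_diff)
    have "[(\<Sum>i<n. a ^ i * b ^ (n - Suc i)) = (\<Sum>i<n. b ^ i * b ^ (n - Suc i))] (mod int p)"
      by (intro cong_sum cong_mult cong_pow c cong_refl)
    also have "(\<Sum>i<n. b ^ i * b ^ (n - Suc i)) = (\<Sum>i<n. b ^ (n - 1))"
      by (intro sum.cong refl) (simp flip: power_add)
    also have "\<dots> = int n * b ^ (n - 1)" by simp
    finally show ?thesis using pn by (simp add: cong_dvd_iff)
  qed
  then obtain c where c: "(\<Sum>i<n. a ^ i * b ^ (n - Suc i)) = int p * c" by blast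
  have "a ^ n - b ^ n = (a - b) * (\<Sum>i<n. a ^ i * b ^ (n - Suc i))"
    by (simp add: power_diff_sumr2 mult.commute)
  also have "\<dots> = int m * (int m * c)" by (simp add: ab c m_def)
  finally have d: "a ^ n - 1 = (b ^ n - 1) + int m * (int m * c)" by simp
  have "((a ^ n - 1) div int m) mod int m = ((b ^ n - 1) div int m) mod int m"
    unfolding d using m0 by simp
  then have "euler_quotient m a = euler_quotient m b"
    unfolding euler_quotient_def cop by (simp only: n_def flip: m_def)
  then show ?thesis by (simp add: s_hat_def a_def b_def m_def)
qed

end

theory Submission
  imports Defs
begin

text \<open>
  The correlation sum has an exact value: three times the sum equals
  \<open>p q\<^sup>2 + 2 q\<^sup>2 + 2 (p - 1)\<close>, so the error term is in fact \<open>2 (p - 1) / 3\<close>.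

  Write \<open>m = p q\<close>. Moving from \<open>n\<close> to \<open>n + m\<close> changes the Euler quotient of a unit \<open>n\<close> by
  \<open>\<phi>(m) / n\<close> modulo \<open>m\<close>. As \<open>p\<close> divides \<open>q - 1\<close>, this increment is a multiple of \<open>p\<close>.
  After division by \<open>p\<close> the signs of \<open>s_hat\<close> at \<open>n, n + m, n + 2 m, \<dots>\<close> become the values
  of the square wave \<open>(-1)\<close> to the power \<open>\<lfloor>x / q\<rfloor>\<close> along an arithmetic progression of integers
  (\<open>sign_s_hat_progression\<close>), whose difference \<open>slope p q n\<close> is invertible modulo \<open>q\<close>.
  The product of the wave at four consecutive terms of a progression is periodic modulo \<open>q\<close> in
  the first term and in the difference (\<open>ap_product_cong\<close>), so the contribution of the row
  \<open>n + j m\<close>, \<open>j < q\<close>, is the sum \<open>ap_sum q d\<close> over all starting points, where \<open>d\<close> is the slope.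

  The slope is a constant times the inverse of \<open>n\<close> modulo \<open>q\<close>, hence takes every nonzero residue
  modulo \<open>q\<close> equally often, \<open>p - 1\<close> times (\<open>sum_ap_sum_slope\<close>). It remains to sum \<open>ap_sum q d\<close>
  over \<open>d\<close>. This function is piecewise linear in \<open>d\<close> (\<open>ap_sum_values\<close>), and its sum over
  \<open>{0..<q}\<close> is \<open>(q\<^sup>2 + 2) / 3\<close> (\<open>sum_ap_sum\<close>). The sum over \<open>d \<noteq> 0\<close> is \<open>(q\<^sup>2 + 2) / 3 - q\<close>, and
  the \<open>m - (p - 1) (q - 1)\<close> rows of non-units, on which \<open>s_hat\<close> vanishes, contribute \<open>q\<close> each.
\<close>

section \<open>Products of a square wave along four-term progressions\<close>

text \<open>
  The wave has period \<open>2 q\<close> rather than \<open>q\<close>: it is the sign \<open>(-1)\<close> to the power \<open>\<lfloor>x / q\<rfloor>\<close>.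
  With this normalisation the sign of the half of \<open>{0..<q}\<close> that contains an integer \<open>y\<close> is the
  wave at \<open>2 y\<close>, and doubling is harmless modulo an odd \<open>q\<close>.
\<close>

definition square_wave :: "int \<Rightarrow> int \<Rightarrow> int" where
  "square_wave q x = (if even (x div q) then 1 else - 1)"

definition ap_product :: "int \<Rightarrow> int \<Rightarrow> int \<Rightarrow> int" where
  "ap_product q x d =
     square_wave q x * square_wave q (x + d) * square_wave q (x + 2 * d) * square_wave q (x + 3 * d)"

definition ap_sum :: "int \<Rightarrow> int \<Rightarrow> int" where
  "ap_sum q d = (\<Sum>x = 0..<q. ap_product q x d)"

lemma square_wave_shift:
  assumes "q > 0"
  shows "square_wave q (x + k * q) = (if even k then 1 else - 1) * square_wave q x"
  using assms by (simp add: square_wave_def)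

lemma square_wave_eq:
  assumes "k * q \<le> x" "x < (k + 1) * q"
  shows "square_wave q x = (if even k then 1 else - 1)"
proof -
  have "x div q = k"
    using assms by (intro div_pos_pos_trivial int_div_pos_eq[of x q k "x - k * q"])
      (auto simp: algebra_simps)
  then show ?thesis by (simp add: square_wave_def)
qed

text \<open>
  Adding \<open>q\<close> to \<open>x\<close> changes the sign of all four factors, and adding \<open>q\<close> to \<open>d\<close> changes it
  \<open>0 + 1 + 2 + 3 = 6\<close> times. Both numbers are even, so although the wave itself is only
  antiperiodic modulo \<open>q\<close>, the product of four of its values is a function of residues modulo \<open>q\<close>.
\<close>

lemma ap_product_cong:
  assumes "q > 0" and x: "[x = y] (mod q)" and d: "[d = e] (mod q)"
  shows "ap_product q x d = ap_product q y e"
proof -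
  obtain k l where [simp]: "y = x + k * q" "e = d + l * q"
    using x d by (metis cong_iff_lin mult.commute)
  have *: "square_wave q (x + k * q + i * (d + l * q))
      = (if even (k + i * l) then 1 else - 1) * square_wave q (x + i * d)" for i
    using square_wave_shift[OF \<open>q > 0\<close>, of "x + i * d" "k + i * l"] by (simp add: algebra_simps)
  show ?thesis
    using *[of 0] *[of 1] *[of 2] *[of 3] by (simp add: ap_product_def)
qed

lemma ap_sum_cong:
  assumes "q > 0" "[d = e] (mod q)"
  shows "ap_sum q d = ap_sum q e"
  unfolding ap_sum_def using assms by (intro sum.cong ap_product_cong) auto

lemma bij_betw_affine_mod:
  fixes b d q :: int
  assumes "q > 0" "coprime d q"
  shows "bij_betw (\<lambda>j. (b + d * j) mod q) {0..<q} {0..<q}"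
proof -
  have inj: "inj_on (\<lambda>j. (b + d * j) mod q) {0..<q}"
  proof (rule inj_onI)
    fix i j assume ij: "i \<in> {0..<q}" "j \<in> {0..<q}" and "(b + d * i) mod q = (b + d * j) mod q"
    then have "[d * i = d * j] (mod q)" by (simp add: cong_def[symmetric] cong_add_lcancel)
    then have "[i = j] (mod q)" using assms cong_mult_lcancel by blast
    with ij show "i = j" by (auto intro: cong_less_imp_eq_int)
  qed
  have "(\<lambda>j. (b + d * j) mod q) ` {0..<q} \<subseteq> {0..<q}" using assms by auto
  then have "(\<lambda>j. (b + d * j) mod q) ` {0..<q} = {0..<q}"
    using inj by (intro endo_inj_surj) auto
  with inj show ?thesis by (simp add: bij_betw_def)
qed

text \<open>
  A progression whose difference is invertible modulo \<open>q\<close> visits every residue once, so its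
  starting point is immaterial.
\<close>

lemma sum_ap_product_orbit:
  assumes "q > 0" "coprime d q"
  shows "(\<Sum>j = 0..<q. ap_product q (b + d * j) e) = ap_sum q e"
proof -
  have "(\<Sum>j = 0..<q. ap_product q (b + d * j) e) = (\<Sum>j = 0..<q. ap_product q ((b + d * j) mod q) e)"
    using assms by (intro sum.cong ap_product_cong) auto
  also have "\<dots> = ap_sum q e"
    unfolding ap_sum_def by (rule sum.reindex_bij_betw[OF bij_betw_affine_mod[OF assms]])
  finally show ?thesis .
qed

section \<open>The sum over all four-term progressions\<close>

lemma sum_four_blocks:
  fixes f :: "int \<Rightarrow> 'a::comm_monoid_add"
  assumes "0 \<le> a" "a \<le> b" "b \<le> c" "c \<le> q"
  shows "sum f {0..<q} = sum f {0..<a} + sum f {a..<b} + sum f {b..<c} + sum f {c..<q}"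
proof -
  have split: "sum f {l..<n} = sum f {l..<m} + sum f {m..<n}" if "l \<le> m" "m \<le> n" for l m n
    using that by (subst sum.union_disjoint[symmetric]) (auto simp: ivl_disj_un)
  show ?thesis
    using assms split[of 0 a q] split[of a b q] split[of b c q] by (simp add: add.assoc)
qed

lemma sum_alternating_blocks:
  fixes f :: "int \<Rightarrow> int"
  assumes "0 \<le> a" "a \<le> b" "b \<le> c" "c \<le> q"
    and "\<And>x. 0 \<le> x \<Longrightarrow> x < a \<Longrightarrow> f x = s" "\<And>x. a \<le> x \<Longrightarrow> x < b \<Longrightarrow> f x = - s"
    and "\<And>x. b \<le> x \<Longrightarrow> x < c \<Longrightarrow> f x = s" "\<And>x. c \<le> x \<Longrightarrow> x < q \<Longrightarrow> f x = - s"
  shows "sum f {0..<q} = s * (2 * a - 2 * b + 2 * c - q)"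
proof -
  have "sum f {0..<q} = sum f {0..<a} + sum f {a..<b} + sum f {b..<c} + sum f {c..<q}"
    using assms(1-4) by (rule sum_four_blocks)
  also have "\<dots> = (\<Sum>x = 0..<a. s) + (\<Sum>x = a..<b. - s) + (\<Sum>x = b..<c. s) + (\<Sum>x = c..<q. - s)"
    using assms(5-8) by (intro arg_cong2[of _ _ _ _ "(+)"] sum.cong) auto
  also have "\<dots> = s * (2 * a - 2 * b + 2 * c - q)"
    using assms(1-4) by (simp add: algebra_simps)
  finally show ?thesis .
qed

text \<open>
  For \<open>x\<close> in \<open>{0..<q}\<close> the factor at \<open>x\<close> is \<open>1\<close>, and as \<open>x\<close> grows each of the other three
  factors changes sign at most once, namely when \<open>x + i * d\<close> reaches a multiple of \<open>q\<close>.
  The three places of change cut \<open>{0..<q}\<close> into four blocks of alternating sign.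
  Their order depends on the position of \<open>d\<close> with respect to \<open>q / 3\<close>, \<open>q / 2\<close> and
  \<open>2 q / 3\<close>, which gives a function of \<open>d\<close> that is linear on each of four intervals.
\<close>

lemma ap_sum_values:
  assumes "q > 0" "0 \<le> d" "d < q"
  shows "3 * d \<le> q \<Longrightarrow> ap_sum q d = q - 4 * d"
    and "q \<le> 3 * d \<Longrightarrow> 2 * d \<le> q \<Longrightarrow> ap_sum q d = 8 * d - 3 * q"
    and "q \<le> 2 * d \<Longrightarrow> 3 * d \<le> 2 * q \<Longrightarrow> ap_sum q d = 5 * q - 8 * d"
    and "2 * q \<le> 3 * d \<Longrightarrow> ap_sum q d = 4 * d - 3 * q"
proof -
  note wave = square_wave_eq[of 0] square_wave_eq[of 1] square_wave_eq[of 2] square_wave_eq[of 3]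
  {
    assume "3 * d \<le> q"
    then have "ap_sum q d = 1 * (2 * (q - 3 * d) - 2 * (q - 2 * d) + 2 * (q - d) - q)"
      unfolding ap_sum_def using assms
      by (intro sum_alternating_blocks) (simp_all add: ap_product_def wave)
    then show "ap_sum q d = q - 4 * d" by simp
  next
    assume "q \<le> 3 * d" "2 * d \<le> q"
    then have "ap_sum q d = (- 1) * (2 * (q - 2 * d) - 2 * (q - d) + 2 * (2 * q - 3 * d) - q)"
      unfolding ap_sum_def using assms
      by (intro sum_alternating_blocks) (simp_all add: ap_product_def wave)
    then show "ap_sum q d = 8 * d - 3 * q" by simp
  next
    assume "q \<le> 2 * d" "3 * d \<le> 2 * q"
    then have "ap_sum q d = 1 * (2 * (2 * q - 3 * d) - 2 * (q - d) + 2 * (2 * q - 2 * d) - q)"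
      unfolding ap_sum_def using assms
      by (intro sum_alternating_blocks) (simp_all add: ap_product_def wave)
    then show "ap_sum q d = 5 * q - 8 * d" by simp
  next
    assume "2 * q \<le> 3 * d"
    then have "ap_sum q d = (- 1) * (2 * (q - d) - 2 * (2 * q - 2 * d) + 2 * (3 * q - 3 * d) - q)"
      unfolding ap_sum_def using assms
      by (intro sum_alternating_blocks) (simp_all add: ap_product_def wave)
    then show "ap_sum q d = 4 * d - 3 * q" by simp
  }
qed

lemma sum_affine:
  fixes m n :: int
  assumes "m \<le> n"
  shows "2 * (\<Sum>e = m..<n. \<alpha> + \<beta> * e) = (n - m) * (2 * \<alpha> + \<beta> * (m + n - 1))"
  using assms
proof (induction n rule: int_ge_induct)
  case (step n)
  then have "{m..<n + 1} = insert n {m..<n}" by auto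
  then show ?case using step by (simp add: algebra_simps)
qed simp

text \<open>
  The leading term \<open>q\<^sup>2 / 3\<close> is the integral of the piecewise linear function of the previous
  lemma; the exact value results from summing its four arithmetic progressions in the two residue
  classes \<open>1\<close> and \<open>5\<close> modulo \<open>6\<close>.
\<close>

lemma sum_ap_sum:
  assumes "q > 0" "odd q" "\<not> 3 dvd q"
  shows "3 * (\<Sum>d = 0..<q. ap_sum q d) = q\<^sup>2 + 2"
proof -
  \<comment> \<open>The least integers exceeding \<open>q / 3\<close>, \<open>q / 2\<close> and \<open>2 q / 3\<close>.\<close>
  define a b c where "a = q div 3 + 1" and "b = q div 2 + 1" and "c = 2 * q div 3 + 1"
  have bounds: "d < a \<longleftrightarrow> 3 * d \<le> q" "d < b \<longleftrightarrow> 2 * d \<le> q" "d < c \<longleftrightarrow> 3 * d \<le> 2 * q" for d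
    unfolding a_def b_def c_def by presburger+
  have abc: "0 \<le> a" "a \<le> b" "b \<le> c" "c \<le> q"
    using assms unfolding a_def b_def c_def by presburger+
  have piece1: "ap_sum q d = q + (- 4) * d" if "0 \<le> d" "d < a" for d
    using that abc bounds[of d] assms(1) by (subst ap_sum_values(1)) auto
  have piece2: "ap_sum q d = - 3 * q + 8 * d" if "a \<le> d" "d < b" for d
    using that abc bounds[of d] assms(1) by (subst ap_sum_values(2)) auto
  have piece3: "ap_sum q d = 5 * q + (- 8) * d" if "b \<le> d" "d < c" for d
    using that abc bounds[of d] assms(1) by (subst ap_sum_values(3)) auto
  have piece4: "ap_sum q d = - 3 * q + 4 * d" if "c \<le> d" "d < q" for d
    using that abc bounds[of d] assms(1) by (subst ap_sum_values(4)) auto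
  have "(\<Sum>d = 0..<q. ap_sum q d) = (\<Sum>d = 0..<a. ap_sum q d) + (\<Sum>d = a..<b. ap_sum q d)
      + (\<Sum>d = b..<c. ap_sum q d) + (\<Sum>d = c..<q. ap_sum q d)"
    using abc by (rule sum_four_blocks)
  also have "\<dots> = (\<Sum>d = 0..<a. q + (- 4) * d) + (\<Sum>d = a..<b. - 3 * q + 8 * d)
      + (\<Sum>d = b..<c. 5 * q + (- 8) * d) + (\<Sum>d = c..<q. - 3 * q + 4 * d)"
    by (intro arg_cong2[of _ _ _ _ "(+)"] sum.cong refl)
      (simp_all add: piece1 piece2 piece3 piece4)
  finally have eq: "2 * (\<Sum>d = 0..<q. ap_sum q d) =
      a * (2 * q - 4 * (a - 1)) + (b - a) * (- 6 * q + 8 * (a + b - 1))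
      + (c - b) * (10 * q - 8 * (b + c - 1)) + (q - c) * (- 6 * q + 4 * (c + q - 1))"
    using abc by (simp only: distrib_left sum_affine) (simp add: algebra_simps)
  have "q mod 6 = 1 \<or> q mod 6 = 5" using assms by presburger
  then consider k where "q = 6 * k + 1" | k where "q = 6 * k + 5"
    by (metis mult_div_mod_eq)
  then show ?thesis
  proof cases
    case (1 k)
    then have "a = 2 * k + 1" "b = 3 * k + 1" "c = 4 * k + 1"
      unfolding a_def b_def c_def by presburger+
    with eq 1 show ?thesis by (simp add: algebra_simps power2_eq_square)
  next
    case (2 k)
    then have "a = 2 * k + 2" "b = 3 * k + 3" "c = 4 * k + 4"
      unfolding a_def b_def c_def by presburger+
    with eq 2 show ?thesis by (simp add: algebra_simps power2_eq_square)
  qed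
qed

section \<open>Euler quotients along a progression of difference \<open>p q\<close>\<close>

abbreviation unreduced_quotient :: "nat \<Rightarrow> int \<Rightarrow> int" where
  "unreduced_quotient m n \<equiv> (n ^ totient m - 1) div int m"

text \<open>
  The binomial expansion to first order; it controls the difference of two Euler quotients,
  which are defined through powers modulo \<open>m\<^sup>2\<close>.
\<close>

lemma power_add_first_order:
  fixes a h m :: int
  assumes "m dvd h"
  shows "[(a + h) ^ k = a ^ k + int k * a ^ (k - 1) * h] (mod m\<^sup>2)"
proof (induction k)
  case (Suc k)
  have "m\<^sup>2 dvd h\<^sup>2" using assms by simp
  then have h: "m\<^sup>2 dvd int k * a ^ (k - 1) * h\<^sup>2" by simp
  have "(a + h) * (a ^ k + int k * a ^ (k - 1) * h)
      = a ^ Suc k + int (Suc k) * a ^ (Suc k - 1) * h + int k * a ^ (k - 1) * h\<^sup>2"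
    by (cases k) (simp_all add: algebra_simps power2_eq_square)
  with h have "[(a + h) * (a ^ k + int k * a ^ (k - 1) * h)
      = a ^ Suc k + int (Suc k) * a ^ (Suc k - 1) * h] (mod m\<^sup>2)"
    by (simp add: cong_iff_dvd_diff)
  moreover have "[(a + h) ^ Suc k = (a + h) * (a ^ k + int k * a ^ (k - 1) * h)] (mod m\<^sup>2)"
    using Suc by (simp add: cong_scalar_left)
  ultimately show ?case by (rule cong_trans[rotated])
qed simp

lemma coprime_add_multiple_iff:
  fixes a m :: "'a::semiring_gcd"
  shows "coprime (a + i * m) m \<longleftrightarrow> coprime a m"
  by (metis add.commute coprime_iff_gcd_eq_1 gcd.commute gcd_add_mult)

lemma unreduced_quotient_shift:
  assumes "m \<ge> 2" "coprime n (int m)"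
  shows "[unreduced_quotient m (n + i * int m)
      = unreduced_quotient m n + i * (int (totient m) * n ^ (totient m - 1))] (mod int m)"
proof -
  let ?k = "totient m"
  have "coprime (n + i * int m) (int m)" 
    using assms(2) by (simp only: coprime_add_multiple_iff)
  then have exact: "int m * unreduced_quotient m (n + i * int m) = (n + i * int m) ^ ?k - 1"
    "int m * unreduced_quotient m n = n ^ ?k - 1"
    using assms euler_quotient_unique(1) by simp_all
  have "[(n + i * int m) ^ ?k - 1
      = n ^ ?k + int ?k * n ^ (?k - 1) * (i * int m) - 1] (mod (int m)\<^sup>2)"
    by (intro cong_diff power_add_first_order) auto
  then have "[int m * unreduced_quotient m (n + i * int m)
      = int m * unreduced_quotient m n + int ?k * n ^ (?k - 1) * (i * int m)] (mod (int m)\<^sup>2)"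
    unfolding exact by (simp only: diff_add_eq)
  also have "int m * unreduced_quotient m n + int ?k * n ^ (?k - 1) * (i * int m)
      = int m * (unreduced_quotient m n + i * (int ?k * n ^ (?k - 1)))"
    by (simp add: algebra_simps)
  finally show ?thesis
    using assms(1) by (simp add: cong_iff_dvd_diff power2_eq_square flip: right_diff_distrib)
qed

text \<open>
  The reduction of the Euler quotient modulo \<open>p q\<close> may be skipped, since twice a multiple of
  \<open>p q\<close> is a period of the wave; and a wave of step \<open>p q\<close> at \<open>x\<close> is the wave of step
  \<open>q\<close> at \<open>x div p\<close>. This is how the modulus \<open>p q\<close> is replaced by \<open>q\<close> with no loss.
\<close>

lemma sign_s_hat:
  assumes "p * q \<ge> 2" "coprime t (p * q)"
  shows "(- 1 :: int) ^ s_hat p q t = square_wave (int q) (2 * unreduced_quotient (p * q) (int t) div int p)"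
proof -
  define m where "m = int (p * q)"
  define R where "R = unreduced_quotient (p * q) (int t)"
  define E where "E = R mod m"
  have m: "m > 0" "real (p * q) = real_of_int m" 
    using assms(1) of_nat_less_iff[of 0 "p * q", where 'a = int] by (auto simp: m_def)
  have E: "0 \<le> E" "E < m" using m by (simp_all add: E_def)
  have "euler_quotient (p * q) (int t) = E"
    using assms(2) by (simp add: euler_quotient_def E_def R_def m_def flip: coprime_int_iff of_nat_mult)
  then have "(- 1 :: int) ^ s_hat p q t = (if 2 * E < m then 1 else - 1)"
    using E m by (simp add: s_hat_def Let_def divide_less_eq flip: of_nat_mult) 
  also have "\<dots> = square_wave m (2 * E)"
    using square_wave_eq[of 0 m "2 * E"] square_wave_eq[of 1 m "2 * E"] E by simp
  also have "\<dots> = square_wave m (2 * E + 2 * (R div m) * m)"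
    using m by (simp only: square_wave_shift) simp
  also have "2 * E + 2 * (R div m) * m = 2 * (R div m * m + E)" by (simp add: algebra_simps)
  also have "\<dots> = 2 * R" by (simp add: E_def)
  also have "square_wave m (2 * R) = square_wave (int q) (2 * R div int p)"
    by (simp add: square_wave_def m_def zdiv_zmult2_eq)
  finally show ?thesis by (simp add: R_def)
qed

text \<open>
  The integer \<open>\<phi>(p q) / p\<close>, where \<open>p\<close> divides \<open>q - 1\<close>.
\<close>

definition cofactor :: "nat \<Rightarrow> nat \<Rightarrow> int" where
  "cofactor p q = int ((p - 1) * ((q - 1) div p))"

text \<open>
  When \<open>n\<close> grows by \<open>p q\<close>, the quotient grows modulo \<open>p q\<close> by \<open>p / 2\<close> times this number, so
  twice the quotient divided by \<open>p\<close>, the argument of the wave, grows by this number up to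
  multiples of \<open>2 q\<close>. By Euler's theorem the number is a constant times the inverse of \<open>n\<close>
  modulo \<open>q\<close>, for \<open>n\<close> coprime to \<open>p q\<close>.
\<close>

definition slope :: "nat \<Rightarrow> nat \<Rightarrow> nat \<Rightarrow> int" where
  "slope p q n = 2 * cofactor p q * int n ^ (totient (p * q) - 1)"

lemma totient_eq_cofactor:
  assumes "prime p" "prime q" "p \<noteq> q" "p dvd q - 1"
  shows "int (totient (p * q)) = int p * cofactor p q"
proof -
  have "totient (p * q) = (p - 1) * (q - 1)"
    using assms by (simp add: totient_mult_coprime primes_coprime totient_prime)
  also have "\<dots> = p * ((p - 1) * ((q - 1) div p))"
    using assms(4) by auto
  finally show ?thesis by (simp only: cofactor_def of_nat_mult)
qed

text \<open>
  Both factors \<open>p - 1\<close> and \<open>(q - 1) / p\<close> lie strictly between \<open>0\<close> and the prime \<open>q\<close>.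
\<close>

lemma coprime_cofactor:
  assumes "prime p" "prime q" "p dvd q - 1"
  shows "coprime (cofactor p q) (int q)"
proof -
  have p: "1 < p" and q: "0 < q - 1"
    using assms(1,2) prime_gt_1_nat by fastforce+
  then have "p \<le> q - 1" using assms(3) dvd_imp_le by blast
  then have "\<not> q dvd p - 1"
    using p by (intro nat_dvd_not_less) auto
  moreover have "0 < (q - 1) div p" "(q - 1) div p < q"
    using p q \<open>p \<le> q - 1\<close> by (auto simp: div_greater_zero_iff intro: le_less_trans[OF div_le_dividend])
  then have "\<not> q dvd (q - 1) div p" by (intro nat_dvd_not_less)
  ultimately have "coprime ((p - 1) * ((q - 1) div p)) q"
    using assms(2) by (metis coprime_commute prime_dvd_mult_iff prime_imp_coprime)
  then show ?thesis by (simp only: cofactor_def coprime_int_iff)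
qed

text \<open>
  The increment of the quotient is a multiple of \<open>p\<close>, because \<open>p\<close> divides \<open>\<phi>(p q)\<close>.
  Hence division by \<open>p\<close> commutes with adding it, and the signs along a progression of difference
  \<open>p q\<close> are exactly the values of the wave along an arithmetic progression.
\<close>

lemma sign_s_hat_progression:
  assumes pq: "prime p" "prime q" "p \<noteq> q" "p dvd q - 1" and "coprime n (p * q)"
  shows "(- 1 :: int) ^ s_hat p q (n + i * (p * q))
    = square_wave (int q) (2 * unreduced_quotient (p * q) (int n) div int p + int i * slope p q n)"
proof -
  let ?R = "unreduced_quotient (p * q)" and ?k = "totient (p * q)"
  have p: "p > 0" "p > 1" "q > 0" using pq prime_gt_0_nat prime_gt_1_nat by auto
  then have m: "p * q \<ge> 2"
    by (metis One_nat_def Suc_1 Suc_leI mult.right_neutral mult_le_mono nat_mult_1_right)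
  have "coprime (n + i * (p * q)) (p * q)"
    using assms(5) by (simp only: coprime_add_multiple_iff)
  then have sign: "(- 1 :: int) ^ s_hat p q (n + i * (p * q))
      = square_wave (int q) (2 * ?R (int n + int i * int (p * q)) div int p)"
    using sign_s_hat[OF m] by simp
  have "coprime (int n) (int (p * q))" using assms(5) by (simp only: coprime_int_iff)
  from unreduced_quotient_shift[OF m this, of "int i"] obtain z where
    "?R (int n + int i * int (p * q))
      = ?R (int n) + int i * (int ?k * int n ^ (?k - 1)) + int (p * q) * z"
    by (metis cong_iff_lin cong_sym)
  then have "2 * ?R (int n + int i * int (p * q))
      = 2 * ?R (int n) + (int i * slope p q n + 2 * z * int q) * int p"
    unfolding totient_eq_cofactor[OF pq] slope_def by (simp add: algebra_simps)
  then have "2 * ?R (int n + int i * int (p * q)) div int p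
      = (2 * ?R (int n) div int p + int i * slope p q n) + 2 * z * int q"
    using p(1) by simp
  with sign show ?thesis using p(3) by (simp add: square_wave_shift)
qed

definition window_sign :: "nat \<Rightarrow> nat \<Rightarrow> nat \<Rightarrow> int" where
  "window_sign p q t = (- 1) ^ (s_hat p q t + s_hat p q (t + p * q)
     + s_hat p q (t + 2 * (p * q)) + s_hat p q (t + 3 * (p * q)))"

lemma window_sign_progression:
  "window_sign p q (n + j * (p * q)) =
     (- 1) ^ s_hat p q (n + j * (p * q)) * (- 1) ^ s_hat p q (n + (j + 1) * (p * q))
     * (- 1) ^ s_hat p q (n + (j + 2) * (p * q)) * (- 1) ^ s_hat p q (n + (j + 3) * (p * q))"
proof -
  have "n + j * (p * q) + p * q = n + (j + 1) * (p * q)"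
    "n + j * (p * q) + 2 * (p * q) = n + (j + 2) * (p * q)"
    "n + j * (p * q) + 3 * (p * q) = n + (j + 3) * (p * q)"
    by (simp_all add: algebra_simps)
  then show ?thesis unfolding window_sign_def by (simp only: power_add)
qed

lemma window_sign_coprime:
  assumes "prime p" "prime q" "p \<noteq> q" "p dvd q - 1" "coprime n (p * q)"
  shows "window_sign p q (n + j * (p * q))
    = ap_product (int q) (2 * unreduced_quotient (p * q) (int n) div int p + slope p q n * int j) (slope p q n)"
  unfolding window_sign_progression ap_product_def sign_s_hat_progression[OF assms]
  by (simp add: algebra_simps)

lemma window_sign_not_coprime:
  assumes "\<not> coprime n (p * q)"
  shows "window_sign p q (n + j * (p * q)) = 1"
proof -
  have not_coprime: "\<not> coprime (n + i * (p * q)) (p * q)" for i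
    using assms by (simp only: coprime_add_multiple_iff not_False_eq_True)
  then have *: "s_hat p q (n + i * (p * q)) = 0" for i
    unfolding s_hat_def euler_quotient_def coprime_int_iff by (simp only: not_coprime if_False) simp
  show ?thesis unfolding window_sign_progression * by simp
qed

lemma sum_window_sign_coprime:
  assumes "prime p" "prime q" "p \<noteq> q" "p dvd q - 1" "odd q" "coprime n (p * q)"
  shows "(\<Sum>j<q. window_sign p q (n + j * (p * q))) = ap_sum (int q) (slope p q n)"
proof -
  let ?b = "2 * unreduced_quotient (p * q) (int n) div int p"
  have "coprime n q" using assms(6) by simp
  then have "coprime (slope p q n) (int q)"
    using coprime_cofactor[OF assms(1,2,4)] assms(5)
    by (simp add: slope_def)
  moreover have "q > 0" using assms(2) prime_gt_0_nat by blast
  ultimately have *: "(\<Sum>j = 0..<int q. ap_product (int q) (?b + slope p q n * j) (slope p q n))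
      = ap_sum (int q) (slope p q n)"
    by (intro sum_ap_product_orbit) auto
  have "bij_betw int {..<q} {0..<int q}"
    by (simp add: bij_betw_def image_int_atLeastLessThan lessThan_atLeast0)
  note reindex = sum.reindex_bij_betw[OF this]
  show ?thesis
    unfolding *[symmetric] window_sign_coprime[OF assms(1-4,6)] by (rule reindex)
qed

section \<open>Equidistribution of the slopes\<close>

text \<open>
  By Fermat's theorem, \<open>r\<close> to the power \<open>k\<close> is the inverse of \<open>r\<close> modulo \<open>q\<close> when
  \<open>q - 1\<close> divides \<open>k + 1\<close>, and inversion permutes the units.
\<close>

lemma bij_betw_inverse_power:
  fixes c :: int
  assumes "prime q" "coprime c (int q)" "q - 1 dvd Suc k"
  shows "bij_betw (\<lambda>r. c * int r ^ k mod int q) (totatives q) {1..<int q}"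
proof -
  let ?f = "\<lambda>r. c * int r ^ k mod int q"
  have q: "q > 1" "q \<ge> 2" using assms(1) prime_gt_1_nat prime_ge_2_nat by auto
  have coprime: "coprime (int r) (int q)" if "r \<in> totatives q" for r
    using that by (simp add: in_totatives_iff)
  have inverse: "[int r ^ k * int r = 1] (mod int q)" if r: "r \<in> totatives q" for r
  proof -
    obtain l where l: "Suc k = (q - 1) * l" using assms(3) by blast
    have "[int r ^ (q - 1) = 1] (mod int q)"
      using euler_quotient_unique(1)[OF q(2) coprime[OF r]] totient_prime[OF assms(1)]
      by (simp add: cong_iff_dvd_diff)
    from cong_pow[OF this, of l] show ?thesis
      by (metis l mult.commute power_Suc power_mult power_one)
  qed
  have inj: "inj_on ?f (totatives q)"
  proof (rule inj_onI)
    fix r s assume rs: "r \<in> totatives q" "s \<in> totatives q" and "?f r = ?f s"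
    then have "[c * int r ^ k = c * int s ^ k] (mod int q)" by (simp add: cong_def)
    then have pow: "[int r ^ k = int s ^ k] (mod int q)"
      using assms(2) cong_mult_lcancel by blast
    \<comment> \<open>Both \<open>r\<close> and \<open>s\<close> are congruent to the product of \<open>r\<close>, \<open>s\<close> and their common inverse.\<close>
    have "[int r * (int s ^ k * int s) = int r * 1] (mod int q)"
      using inverse[OF rs(2)] by (rule cong_scalar_left)
    moreover have "[int r * (int s ^ k * int s) = int r * (int r ^ k * int s)] (mod int q)"
      using pow by (intro cong_mult cong_refl cong_sym[OF pow])
    moreover have "[int s * (int r ^ k * int r) = int s * 1] (mod int q)"
      using inverse[OF rs(1)] by (rule cong_scalar_left)
    ultimately have "[int r = int s] (mod int q)"
      by (simp add: mult.commute mult.left_commute) (metis cong_sym cong_trans)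
    then have "[r = s] (mod q)" by (simp add: cong_int_iff)
    then show "r = s"
      using rs q totatives_less by (metis cong_less_modulus_unique_nat)
  qed
  have "?f ` totatives q \<subseteq> {1..<int q}"
  proof safe
    fix r assume "r \<in> totatives q"
    then have "coprime (c * int r ^ k) (int q)" using coprime assms(2) by simp
    then have "?f r \<noteq> 0"
      using q coprime_common_divisor[of "c * int r ^ k" "int q" "int q"] by auto
    moreover have "0 \<le> ?f r" "?f r < int q" using q by simp_all
    ultimately show "?f r \<in> {1..<int q}" by simp
  qed
  moreover have "card (?f ` totatives q) = card {1..<int q}"
    using inj q by (simp add: card_image totatives_prime[OF assms(1)])
  ultimately have "?f ` totatives q = {1..<int q}" by (intro card_subset_eq) auto
  with inj show ?thesis by (simp add: bij_betw_def)
qed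

text \<open>
  The slope depends only on \<open>n\<close> modulo \<open>q\<close>. By the Chinese remainder theorem each unit modulo
  \<open>q\<close> is the residue of \<open>p - 1\<close> units modulo \<open>p q\<close>, and the slope runs through all units
  as the residue does.
\<close>

lemma sum_ap_sum_slope:
  assumes "prime p" "prime q" "p \<noteq> q" "p dvd q - 1" "odd q"
  shows "(\<Sum>n\<in>totatives (p * q). ap_sum (int q) (slope p q n))
    = int (p - 1) * (\<Sum>d = 1..<int q. ap_sum (int q) d)"
proof -
  let ?k = "totient (p * q) - 1"
  let ?c = "2 * cofactor p q"
  define g where "g r = ap_sum (int q) (?c * int r ^ ?k mod int q)" for r
  have gt1: "p > 1" "q > 1" using assms prime_gt_1_nat by auto
  then have q: "int q > 0" by simp
  have cop: "coprime p q" using assms by (simp add: primes_coprime)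
  have "totient (p * q) = (p - 1) * (q - 1)"
    using assms cop by (simp add: totient_mult_coprime totient_prime)
  then have dvd: "q - 1 dvd Suc ?k"
    using gt1 by simp
  have "coprime ?c (int q)"
    using coprime_cofactor[OF assms(1,2,4)] assms(5) by simp
  note bij = bij_betw_inverse_power[OF assms(2) this dvd]
  have g: "ap_sum (int q) (slope p q n) = g (n mod q)" for n
  proof -
    have "[int n = int (n mod q)] (mod int q)" by (simp add: cong_def zmod_int)
    then have "[slope p q n = ?c * int (n mod q) ^ ?k mod int q] (mod int q)"
      unfolding slope_def cong_mod_right by (intro cong_mult cong_pow cong_refl)
    then show ?thesis unfolding g_def by (rule ap_sum_cong[OF q])
  qed
  have "(\<Sum>n\<in>totatives (p * q). ap_sum (int q) (slope p q n))
      = (\<Sum>n\<in>totatives (p * q). (\<lambda>(u, r). g r) (n mod p, n mod q))"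
    by (simp add: g)
  also have "\<dots> = (\<Sum>(u, r)\<in>totatives p \<times> totatives q. g r)"
    by (rule sum.reindex_bij_betw[OF bij_betw_totatives[OF gt1 cop]])
  also have "\<dots> = int (p - 1) * (\<Sum>r\<in>totatives q. g r)"
    using totient_prime[OF assms(1)] by (simp add: sum.cartesian_product[symmetric] totient_def)
  also have "(\<Sum>r\<in>totatives q. g r) = (\<Sum>d = 1..<int q. ap_sum (int q) d)"
    unfolding g_def by (rule sum.reindex_bij_betw[OF bij])
  finally show ?thesis .
qed

section \<open>The exact value of the correlation sum\<close>

text \<open>
  The times are arranged in rows \<open>n + j p q\<close> with \<open>n < p q\<close> fixed and \<open>j < q\<close>. A row whose \<open>n\<close> is
  a unit contributes \<open>ap_sum\<close> at its slope, and any other row contributes \<open>q\<close>.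
  The difference \<open>d = 0\<close>, which is not a slope, accounts for \<open>q\<close> in the complete sum over
  \<open>d\<close> and is subtracted.
\<close>

lemma sum_window_sign:
  assumes "prime p" "prime q" "odd p" "odd q" "p \<noteq> q" "p dvd q - 1"
  shows "3 * (\<Sum>t<p * q ^ 2. window_sign p q t) = int (p * q ^ 2 + 2 * q ^ 2 + 2 * (p - 1))"
proof -
  define m where "m = p * q"
  have gt1: "p > 1" "q > 1" using assms prime_gt_1_nat by auto
  then have m: "m > 1" unfolding m_def by (rule less_1_mult)
  \<comment> \<open>Since \<open>p \<ge> 3\<close> divides the positive number \<open>q - 1\<close>, the prime \<open>q\<close> exceeds \<open>3\<close>.\<close>
  have "p \<le> q - 1" using assms(6) gt1 by (intro dvd_imp_le) auto
  moreover have "p \<ge> 3" using gt1 assms(3) by (cases "p = 2") auto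
  ultimately have "q > 3" by simp
  then have "\<not> 3 dvd q" using assms(2) \<open>q > 3\<close> by (auto simp: prime_nat_iff)
  then have three: "\<not> 3 dvd int q" by presburger
  have tot: "card (totatives m) = (p - 1) * (q - 1)"
    using assms by (simp add: m_def totient_def[symmetric] totient_mult_coprime totient_prime primes_coprime)
  have totatives: "totatives m = {n \<in> {..<m}. coprime n m}"
  proof (intro equalityI subsetI)
    fix n assume "n \<in> totatives m"
    then show "n \<in> {n \<in> {..<m}. coprime n m}"
      using totatives_less[of n m] m by (simp add: in_totatives_iff)
  next
    fix n assume n: "n \<in> {n \<in> {..<m}. coprime n m}"
    then have "n \<noteq> 0" using m by (intro notI) simp
    with n show "n \<in> totatives m" by (simp add: in_totatives_iff)
  qed
  then have subset: "totatives m \<subseteq> {..<m}" by blast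
  have row: "(\<Sum>j<q. window_sign p q (n + j * m))
      = (if n \<in> totatives m then ap_sum (int q) (slope p q n) else int q)" if "n < m" for n
  proof (cases "coprime n m")
    case True
    then have "(\<Sum>j<q. window_sign p q (n + j * m)) = ap_sum (int q) (slope p q n)"
      unfolding m_def using assms by (intro sum_window_sign_coprime)
    with True that show ?thesis by (simp add: totatives)
  next
    case False
    then have "window_sign p q (n + j * m) = 1" for j
      unfolding m_def by (rule window_sign_not_coprime)
    with False show ?thesis by (simp add: totatives)
  qed
  have "(\<Sum>t<p * q ^ 2. window_sign p q t) = (\<Sum>j<q. \<Sum>t = j * m..<j * m + m. window_sign p q t)"
    unfolding sum.nat_group by (simp add: m_def power2_eq_square mult_ac)
  also have "\<dots> = (\<Sum>j<q. \<Sum>n<m. window_sign p q (n + j * m))"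
  proof (rule sum.cong[OF refl])
    fix j
    show "(\<Sum>t = j * m..<j * m + m. window_sign p q t) = (\<Sum>n<m. window_sign p q (n + j * m))"
      using sum.shift_bounds_nat_ivl[of "window_sign p q" 0 "j * m" m]
      by (simp add: lessThan_atLeast0 add.commute)
  qed
  also have "\<dots> = (\<Sum>n<m. \<Sum>j<q. window_sign p q (n + j * m))"
    by (rule sum.swap)
  also have "\<dots> = (\<Sum>n<m. if n \<in> totatives m then ap_sum (int q) (slope p q n) else int q)"
    by (intro sum.cong refl row) auto
  also have "\<dots> = (\<Sum>n\<in>totatives m. ap_sum (int q) (slope p q n)) + (\<Sum>n\<in>{..<m} - totatives m. int q)"
    using subset by (subst sum.subset_diff[OF subset]) (simp_all add: add.commute cong: sum.cong_simp)
  also have "(\<Sum>n\<in>totatives m. ap_sum (int q) (slope p q n))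
      = int (p - 1) * (\<Sum>d = 1..<int q. ap_sum (int q) d)"
    unfolding m_def using assms by (intro sum_ap_sum_slope)
  also have "(\<Sum>n\<in>{..<m} - totatives m. int q) = (int m - int ((p - 1) * (q - 1))) * int q"
    using subset tot card_mono[of "{..<m}" "totatives m"]
    by (subst sum_constant) (simp add: card_Diff_subset of_nat_diff)
  finally have total: "(\<Sum>t<p * q ^ 2. window_sign p q t)
      = int (p - 1) * (\<Sum>d = 1..<int q. ap_sum (int q) d) + (int m - int ((p - 1) * (q - 1))) * int q" .
  have "{0..<int q} = insert 0 {1..<int q}" using gt1 by auto
  then have "(\<Sum>d = 0..<int q. ap_sum (int q) d) = int q + (\<Sum>d = 1..<int q. ap_sum (int q) d)"
    using gt1 ap_sum_values(1)[of "int q" 0] by simp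
  moreover have "3 * (\<Sum>d = 0..<int q. ap_sum (int q) d) = (int q)\<^sup>2 + 2"
    using gt1 assms(4) three by (intro sum_ap_sum) auto
  ultimately have "3 * (\<Sum>d = 1..<int q. ap_sum (int q) d) = (int q)\<^sup>2 + 2 - 3 * int q"
    by simp
  then have "3 * (\<Sum>t<p * q ^ 2. window_sign p q t)
      = int (p - 1) * ((int q)\<^sup>2 + 2 - 3 * int q) + 3 * ((int m - int ((p - 1) * (q - 1))) * int q)"
    unfolding total distrib_left mult.left_commute[of 3 "int (p - 1)"] by simp
  also have "\<dots> = int (p * q ^ 2 + 2 * q ^ 2 + 2 * (p - 1))"
  proof -
    have "int (p - 1) = int p - 1" "int (q - 1) = int q - 1" using gt1 by simp_all
    then show ?thesis
      unfolding m_def of_nat_mult of_nat_add of_nat_power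
      by (simp add: algebra_simps power2_eq_square)
  qed
  finally show ?thesis .
qed

theorem corollary2:
  shows "\<exists>C::real. C > 0 \<and>
    (\<forall>p q :: nat. prime p \<and> prime q \<and> odd p \<and> odd q \<and> p \<noteq> q \<and> p dvd (q - 1) \<longrightarrow>
      \<bar>(\<Sum>t = 0..p * q ^ 2 - 1.
           (-1 :: real) ^ (s_hat p q t + s_hat p q (t + p * q)
             + s_hat p q (t + 2 * (p * q)) + s_hat p q (t + 3 * (p * q))))
         - (1 / 3 * (real p * real q ^ 2) + 2 / 3 * real q ^ 2)\<bar>
      \<le> C * (real p * real q powr (3 / 2) * ln (real (p * q)) ^ 4))"
proof (rule exI[of _ 1], intro conjI allI impI)
  fix p q :: nat
  assume pq: "prime p \<and> prime q \<and> odd p \<and> odd q \<and> p \<noteq> q \<and> p dvd (q - 1)"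
  let ?S = "\<Sum>t = 0..p * q ^ 2 - 1. (-1 :: real) ^ (s_hat p q t + s_hat p q (t + p * q)
             + s_hat p q (t + 2 * (p * q)) + s_hat p q (t + 3 * (p * q)))"
  have gt1: "p > 1" "q > 1" using pq prime_gt_1_nat by auto
  then have "{0..p * q ^ 2 - 1} = {..<p * q ^ 2}"
    by (simp add: atLeast0AtMost flip: lessThan_Suc_atMost)
  then have "?S = of_int (\<Sum>t<p * q ^ 2. window_sign p q t)"
    by (simp add: window_sign_def)
  moreover have "3 * real_of_int (\<Sum>t<p * q ^ 2. window_sign p q t)
      = real (p * q ^ 2 + 2 * q ^ 2 + 2 * (p - 1))"
    using arg_cong[OF sum_window_sign[of p q], of real_of_int] pq by simp
  ultimately have "?S - (1 / 3 * (real p * real q ^ 2) + 2 / 3 * real q ^ 2) = 2 / 3 * real (p - 1)"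
    by simp
  moreover have "2 / 3 * real (p - 1) \<le> real p * 1 * 1" using gt1 by simp
  moreover have "real p * 1 * 1 \<le> real p * real q powr (3 / 2) * ln (real (p * q)) ^ 4"
  proof (intro mult_mono mult_nonneg_nonneg)
    show "1 \<le> real q powr (3 / 2)" using gt1 by (intro ge_one_powr_ge_zero) auto
    have "2 * 2 \<le> p * q" using gt1 by (intro mult_le_mono) auto
    then have "exp 1 \<le> real (p * q)" using exp_le by linarith
    then have "1 \<le> ln (real (p * q))" using gt1 by (subst ln_ge_iff) auto
    then show "1 \<le> ln (real (p * q)) ^ 4" by (rule one_le_power)
  qed auto
  ultimately show "\<bar>?S - (1 / 3 * (real p * real q ^ 2) + 2 / 3 * real q ^ 2)\<bar>
      \<le> 1 * (real p * real q powr (3 / 2) * ln (real (p * q)) ^ 4)"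
    by simp
qed simp

end
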